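(* Let $A$ be a coherent quantale with reticulation $(L(A),\lambda_A)$. Then: (1) if $a\in A$ is w-pure, then $\rho(a)$ is w-pure; (2) an ideal $J$ of $L(A)$ is a $\sigma$-ideal if and only if $J_{\ast}$ is a w-pure element of $A$.
   Context: A quantale is a complete lattice $(A,\vee,\wedge,0,1)$ with an associative multiplication distributing over arbitrary joins in each variable. All quantales are assumed commutative and integral ($1$ is the multiplicative unit). $K(A)$ is the set of compact elements. $A$ is algebraic if every element is a join of compact elements; $A$ is coherent if it is algebraic, $1\in K(A)$ and $K(A)$ is closed under multiplication. $a\rightarrow b=\bigvee\{x\in A: ax\le b\}$. An element $p<1$ is $m$-prime if $ab\le p$ implies $a\le p$ or $b\le p$; $\mathrm{Spec}(A)$ is the set of $m$-prime elements; $\rho(a)=\bigwedge\{p\in \mathrm{Spec}(A): a\le p\}$. An element $a$ is w-pure if for all $c\in K(A)$, $c\le a$ implies $a\vee(c\rightarrow\rho(0))=1$. The reticulation of a coherent quantale $A$ is the (unique up to isomorphism) bounded distributive lattice $L(A)$ together with a surjective map $\lambda_A:K(A)\to L(A)$ such that for all $a,b\in K(A)$: $\lambda_A(a\vee b)\le\lambda_A(a)\vee\lambda_A(b)$; $\lambda_A(ab)=\lambda_A(a)\wedge\lambda_A(b)$; $\lambda_A(a)\le\lambda_A(b)$ iff $a^n\le b$ for some integer $n\ge1$. For an ideal $J$ of $L(A)$, $J_{\ast}=\bigvee\{c\in K(A):\lambda_A(c)\in J\}$. An ideal $J$ of a bounded distributive lattice $L$ is a $\sigma$-ideal if for all $x\in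 J$ one has $J\vee \mathrm{Ann}(x)=L$ (join of ideals), where $\mathrm{Ann}(x)=\{y\in L: x\wedge y=0\}$. *)

theory Defs
  imports Main "HOL.Hull"
begin

definition (in complete_lattice) compact_element :: "'a \<Rightarrow> bool" where
  "compact_element a \<longleftrightarrow> (\<forall>S. a \<le> Sup S \<longrightarrow> (\<exists>F. finite F \<and> F \<subseteq> S \<and> a \<le> Sup F))"

text \<open>
  Commutative integral quantales: the multiplicative unit \<open>1\<close> is the greatest element
  \<open>top\<close>; the least element is \<open>bot\<close>. By commutativity, distributivity in one variable suffices.
\<close>
class quantale = complete_lattice + comm_monoid_mult +
  assumes one_eq_top: "1 = top"
    and mult_Sup_distrib: "a * Sup S = Sup ((\<lambda>x. a * x) ` S)"

class coherent_quantale = quantale +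
  assumes algebraic: "\<exists>S. (\<forall>c\<in>S. compact_element c) \<and> a = Sup S"
    and compact_one: "compact_element 1"
    and compact_mult: "compact_element a \<Longrightarrow> compact_element b \<Longrightarrow> compact_element (a * b)"

definition residual :: "'a::quantale \<Rightarrow> 'a \<Rightarrow> 'a" where
  "residual a b = Sup {x. a * x \<le> b}"

definition m_prime :: "'a::quantale \<Rightarrow> bool" where
  "m_prime p \<longleftrightarrow> p < 1 \<and> (\<forall>a b. a * b \<le> p \<longrightarrow> a \<le> p \<or> b \<le> p)"

definition Spec :: "'a::quantale set" where
  "Spec = {p. m_prime p}"

definition radical :: "'a::quantale \<Rightarrow> 'a" where
  "radical a = Inf {p \<in> Spec. a \<le> p}"

definition w_pure :: "'a::quantale \<Rightarrow> bool" where
  "w_pure a \<longleftrightarrow>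
    (\<forall>c. compact_element c \<and> c \<le> a \<longrightarrow> sup a (residual c (radical bot)) = 1)"

text \<open>
  The map \<open>lam\<close> is a total function on \<open>'a\<close>, but only its values on compact elements are
  constrained or used. The type \<open>'b\<close> is the bounded distributive lattice \<open>L(A)\<close>.
\<close>
definition reticulation ::
    "('a::coherent_quantale \<Rightarrow> 'b::{distrib_lattice, bounded_lattice}) \<Rightarrow> bool" where
  "reticulation lam \<longleftrightarrow>
    lam ` {c. compact_element c} = UNIV \<and>
    (\<forall>a b. compact_element a \<and> compact_element b \<longrightarrow>
       lam (sup a b) \<le> sup (lam a) (lam b) \<and>
       lam (a * b) = inf (lam a) (lam b) \<and>
       (lam a \<le> lam b \<longleftrightarrow> (\<exists>n\<ge>1. a ^ n \<le> b)))"

definition lattice_ideal :: "'b::bounded_lattice set \<Rightarrow> bool" where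
  "lattice_ideal J \<longleftrightarrow>
    J \<noteq> {} \<and> (\<forall>x\<in>J. \<forall>y\<in>J. sup x y \<in> J) \<and> (\<forall>x\<in>J. \<forall>y. y \<le> x \<longrightarrow> y \<in> J)"

text \<open>The join in the lattice of ideals, i.e. the smallest ideal containing both ideals.\<close>
definition ideal_join :: "'b::bounded_lattice set \<Rightarrow> 'b set \<Rightarrow> 'b set" where
  "ideal_join I J = lattice_ideal hull (I \<union> J)"

definition Ann :: "'b::bounded_lattice \<Rightarrow> 'b set" where
  "Ann x = {y. inf x y = bot}"

definition sigma_ideal :: "'b::{distrib_lattice, bounded_lattice} set \<Rightarrow> bool" where
  "sigma_ideal J \<longleftrightarrow> lattice_ideal J \<and> (\<forall>x\<in>J. ideal_join J (Ann x) = UNIV)"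

text \<open>The element \<open>J\<^sub>*\<close> associated with an ideal \<open>J\<close> of the reticulation.\<close>
definition lower_star ::
    "('a::coherent_quantale \<Rightarrow> 'b::{distrib_lattice, bounded_lattice}) \<Rightarrow> 'b set \<Rightarrow> 'a" where
  "lower_star lam J = Sup {c. compact_element c \<and> lam c \<in> J}"

end

theory Submission
  imports Defs
begin

text \<open>
  By Zorn's lemma a compact element lies below \<open>radical a\<close> iff one of its powers lies below \<open>a\<close>.
  Since \<open>radical bot\<close> is a radical element, \<open>c ^ n\<close> and \<open>c\<close> have the same residual over it,
  which gives (1). For (2), a compact \<open>c\<close> satisfies \<open>c \<le> J\<^sub>*\<close> iff \<open>lam c \<in> J\<close>, and
  \<open>lam c = bot\<close> iff \<open>c \<le> radical bot\<close>; as \<open>1\<close> is compact, both the \<open>\<sigma>\<close>-ideal condition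
  at \<open>lam c\<close> and the w-purity condition at \<open>c\<close> say that there are compact \<open>d \<le> J\<^sub>*\<close> and \<open>e\<close>
  with \<open>c * e \<le> radical bot\<close> and \<open>sup d e = 1\<close>.
\<close>

section \<open>Multiplication and residuals in a quantale\<close>

lemma mult_sup_distrib: "a * sup x y = sup (a * x) (a * y)" for a :: "'a::quantale"
  using mult_Sup_distrib[of a "{x, y}"] by simp

lemma quantale_le_one: "a \<le> 1" for a :: "'a::quantale"
  by (simp add: one_eq_top)

lemma one_le_iff: "1 \<le> a \<longleftrightarrow> a = 1" for a :: "'a::quantale"
  by (simp add: one_eq_top top_unique)

lemma quantale_mult_left_mono: "x \<le> y \<Longrightarrow> a * x \<le> a * y" for a :: "'a::quantale"
  by (metis le_iff_sup mult_sup_distrib)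

lemma quantale_mult_mono: "a \<le> b \<Longrightarrow> x \<le> y \<Longrightarrow> a * x \<le> b * y" for a :: "'a::quantale"
  by (metis mult.commute order_trans quantale_mult_left_mono)

lemma mult_le_left: "a * b \<le> a" for a :: "'a::quantale"
  using quantale_mult_left_mono[OF quantale_le_one, of a b] by simp

lemma mult_le_right: "a * b \<le> b" for a :: "'a::quantale"
  by (metis mult.commute mult_le_left)

text \<open>In the expanded product every term except \<open>x * y\<close> has a factor
  \<open>p\<close>, so it lies below \<open>p\<close> by integrality. This gives primality of the
  maximal element found by Zorn's lemma.\<close>

lemma sup_mult_sup_le: "sup p x * sup p y \<le> sup p (x * y)" for p :: "'a::quantale"
proof -
  have "sup p x * sup p y = sup (p * sup p y) (sup (x * p) (x * y))"
    by (metis mult.commute mult_sup_distrib)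
  also have "\<dots> \<le> sup p (x * y)"
    by (intro le_supI) (auto intro: le_supI1 mult_le_left mult_le_right)
  finally show ?thesis .
qed

text \<open>Multiplication preserves joins, so the join defining \<open>residual a b\<close> itself
  satisfies the defining inequality.\<close>

lemma residual_galois: "x \<le> residual a b \<longleftrightarrow> a * x \<le> b" for a :: "'a::quantale"
proof
  have "a * residual a b \<le> b"
    unfolding residual_def mult_Sup_distrib by (auto intro: Sup_least)
  then show "a * x \<le> b" if "x \<le> residual a b"
    using that quantale_mult_left_mono order_trans by blast
qed (simp add: residual_def Sup_upper)

section \<open>Radicals and powers\<close>

lemma le_radical: "a \<le> radical a"
  unfolding radical_def by (auto intro: Inf_greatest)

lemma m_prime_power: "m_prime p \<Longrightarrow> x ^ n \<le> p \<Longrightarrow> x \<le> p"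
proof (induction n)
  case 0
  \<comment> \<open>Here the hypothesis reads \<open>1 \<le> p\<close>, and \<open>1\<close> is the
    greatest element.\<close>
  then show ?case by (metis power_0 quantale_le_one order_trans)
next
  case (Suc n)
  then show ?case by (auto simp: m_prime_def)
qed

lemma radical_power:
  assumes "x ^ n \<le> radical a"
  shows "x \<le> radical a"
  unfolding radical_def
proof (rule Inf_greatest)
  fix p assume p: "p \<in> {p \<in> Spec. a \<le> p}"
  then have "radical a \<le> p" unfolding radical_def by (rule Inf_lower)
  with assms have "x ^ n \<le> p" by simp
  with p show "x \<le> p" by (auto simp: Spec_def intro: m_prime_power)
qed

text \<open>With \<open>r\<close> the left-hand residual, \<open>(c * r) ^ n\<close> is below
  \<open>c ^ n * r\<close>, hence below \<open>radical a\<close>; the radical then absorbs the root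
  \<open>c * r\<close>.\<close>

lemma residual_power_radical_le:
  assumes "n \<ge> 1"
  shows "residual (c ^ n) (radical a) \<le> residual c (radical a)"
proof -
  let ?r = "residual (c ^ n) (radical a)"
  \<comment> \<open>A positive exponent leaves at least one factor \<open>?r\<close>; the zeroth
    power would be \<open>1\<close>.\<close>
  have "?r ^ n \<le> ?r"
    using assms mult_le_left by (cases n) auto
  then have "(c * ?r) ^ n \<le> c ^ n * ?r"
    by (simp add: power_mult_distrib quantale_mult_left_mono)
  also have "\<dots> \<le> radical a" using residual_galois by blast
  finally show ?thesis unfolding residual_galois by (rule radical_power)
qed

section \<open>Compact elements\<close>

lemma compact_sup:
  "compact_element a \<Longrightarrow> compact_element b \<Longrightarrow> compact_element (sup a b)"
  for a :: "'a::complete_lattice"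
  unfolding compact_element_def
proof (intro allI impI)
  fix S
  assume *: "\<forall>S. a \<le> Sup S \<longrightarrow> (\<exists>F. finite F \<and> F \<subseteq> S \<and> a \<le> Sup F)"
    "\<forall>S. b \<le> Sup S \<longrightarrow> (\<exists>F. finite F \<and> F \<subseteq> S \<and> b \<le> Sup F)" and "sup a b \<le> Sup S"
  then obtain F G where "finite F" "F \<subseteq> S" "a \<le> Sup F" "finite G" "G \<subseteq> S" "b \<le> Sup G"
    by (metis le_sup_iff)
  then show "\<exists>F. finite F \<and> F \<subseteq> S \<and> sup a b \<le> Sup F"
    by (intro exI[of _ "F \<union> G"]) (auto simp: Sup_union_distrib intro: le_supI1 le_supI2)
qed

lemma compact_bot: "compact_element (bot :: 'a::complete_lattice)"
  unfolding compact_element_def by (intro allI impI exI[of _ "{}"]) auto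

lemma compact_Sup:
  "finite F \<Longrightarrow> \<forall>c\<in>F. compact_element c \<Longrightarrow> compact_element (Sup F)"
  for F :: "'a::complete_lattice set"
  by (induction F rule: finite_induct) (auto intro: compact_sup compact_bot)

lemma compact_power: "compact_element c \<Longrightarrow> compact_element (c ^ n)"
  for c :: "'a::coherent_quantale"
  by (induction n) (auto intro: compact_one compact_mult)

lemma Sup_compact_below: "Sup {c. compact_element c \<and> c \<le> a} = a"
  for a :: "'a::coherent_quantale"
proof (rule antisym)
  obtain S where "\<forall>c\<in>S. compact_element c" "a = Sup S" using algebraic by blast
  then show "a \<le> Sup {c. compact_element c \<and> c \<le> a}"
    by (simp add: Sup_subset_mono Sup_upper subset_iff)
qed (auto intro: Sup_least)

text \<open>Both \<open>a\<close> and \<open>b\<close> are joins of the compact elements below them.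
  A finite subfamily covering \<open>c\<close> splits into a part below \<open>a\<close> and a part
  below \<open>b\<close>, and the two finite joins are compact.\<close>

lemma compact_le_sup:
  fixes a b :: "'a::coherent_quantale"
  assumes "compact_element c" "c \<le> sup a b"
  obtains d e where "compact_element d" "d \<le> a" "compact_element e" "e \<le> b" "c \<le> sup d e"
proof -
  let ?K = "\<lambda>a. {c. compact_element c \<and> c \<le> a}"
  have "c \<le> Sup (?K a \<union> ?K b)"
    using assms(2) by (simp only: Sup_union_distrib Sup_compact_below)
  then obtain F where F: "finite F" "F \<subseteq> ?K a \<union> ?K b" "c \<le> Sup F"
    using assms(1) unfolding compact_element_def[of c] by blast
  show thesis
  proof
    show "compact_element (Sup (F \<inter> ?K a))" "compact_element (Sup (F \<inter> ?K b))"
      by (rule compact_Sup; use F(1) in simp)+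
    show "Sup (F \<inter> ?K a) \<le> a" "Sup (F \<inter> ?K b) \<le> b" by (auto intro: Sup_least)
    have "F \<inter> ?K a \<union> F \<inter> ?K b = F" using F(2) by blast
    with F(3) show "c \<le> sup (Sup (F \<inter> ?K a)) (Sup (F \<inter> ?K b))"
      by (simp only: flip: Sup_union_distrib)
  qed
qed

section \<open>Prime elements from Zorn's lemma\<close>

lemma finite_chain_Max:
  fixes F :: "'a::order set"
  assumes "finite F" "F \<noteq> {}" "\<And>x y. x \<in> F \<Longrightarrow> y \<in> F \<Longrightarrow> x \<le> y \<or> y \<le> x"
  shows "\<exists>m\<in>F. \<forall>x\<in>F. x \<le> m"
proof -
  obtain m where m: "m \<in> F" "\<forall>x\<in>F. m \<le> x \<longrightarrow> m = x"
    using finite_has_maximal[OF assms(1,2)] by blast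
  have "x \<le> m" if "x \<in> F" for x
    using assms(3)[OF that m(1)]
  proof
    assume "m \<le> x"
    with m(2) that have "m = x" by blast
    then show ?thesis by simp
  qed
  with m(1) show ?thesis by blast
qed

text \<open>An element maximal among those above \<open>a\<close> and above no power of
  \<open>c\<close> is m-prime. Compactness of the powers of \<open>c\<close> makes joins of chains
  stay in this set.\<close>

lemma m_prime_avoiding_powers:
  fixes a c :: "'a::coherent_quantale"
  assumes c: "compact_element c" and n: "\<And>n. \<not> c ^ n \<le> a"
  obtains p where "m_prime p" "a \<le> p" "\<not> c \<le> p"
proof -
  let ?A = "{x. a \<le> x \<and> (\<forall>n. \<not> c ^ n \<le> x)}"
  have "\<exists>p\<in>?A. \<forall>x\<in>?A. p \<le> x \<longrightarrow> x = p"
  proof (rule predicate_Zorn)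
    show "partial_order_on ?A (relation_of (\<le>) ?A)"
      by (rule partial_order_on_relation_ofI) auto
    fix C assume "C \<in> Chains (relation_of (\<le>) ?A)"
    then have C: "C \<subseteq> ?A" "\<And>x y. x \<in> C \<Longrightarrow> y \<in> C \<Longrightarrow> x \<le> y \<or> y \<le> x"
      by (auto simp: Chains_def relation_of_def)
    show "\<exists>u\<in>?A. \<forall>x\<in>C. x \<le> u"
    \<comment> \<open>Adding \<open>a\<close> keeps the bound above \<open>a\<close> even when the
      chain is empty.\<close>
    proof (intro bexI[of _ "Sup (insert a C)"] ballI)
      have "\<not> c ^ n \<le> Sup (insert a C)" for n
      proof
        assume "c ^ n \<le> Sup (insert a C)"
        then obtain F where F: "finite F" "F \<subseteq> insert a C" "c ^ n \<le> Sup F"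
          using compact_power[OF c] unfolding compact_element_def by metis
        \<comment> \<open>The set is nonempty even for empty \<open>F\<close>, and it is a chain
          because \<open>a\<close> lies below every member of \<open>C\<close>.\<close>
        have "\<exists>m\<in>insert a F. \<forall>x\<in>insert a F. x \<le> m"
          using C F by (intro finite_chain_Max) blast+
        then obtain m where m: "m \<in> insert a F" "Sup F \<le> m"
          by (meson Sup_least insertI2)
        have "insert a F \<subseteq> ?A" using C(1) F(2) n by auto
        with m have "m \<in> ?A" by blast
        moreover from F(3) m(2) have "c ^ n \<le> m" by (rule order_trans)
        ultimately show False by blast
      qed
      then show "Sup (insert a C) \<in> ?A" by simp
    qed (auto intro: le_supI2 Sup_upper)
  qed
  then obtain p where p: "a \<le> p" "\<And>n. \<not> c ^ n \<le> p"
    and max: "\<And>x. p \<le> x \<Longrightarrow> \<forall>n. \<not> c ^ n \<le> x \<Longrightarrow> x = p"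
    by (auto dest: order_trans)
  \<comment> \<open>By maximality, any proper enlargement of \<open>p\<close> lies above some power
    of \<open>c\<close>.\<close>
  have above: "\<exists>n. c ^ n \<le> sup p x" if "\<not> x \<le> p" for x
    using max[of "sup p x"] that by (metis sup.cobounded1 sup.cobounded2)
  have "x \<le> p \<or> y \<le> p" if "x * y \<le> p" for x y
  proof (rule ccontr)
    assume "\<not> (x \<le> p \<or> y \<le> p)"
    then obtain i j where "c ^ i \<le> sup p x" "c ^ j \<le> sup p y" using above by blast
    then have "c ^ (i + j) \<le> sup p x * sup p y"
      unfolding power_add by (rule quantale_mult_mono)
    also have "\<dots> \<le> sup p (x * y)" by (rule sup_mult_sup_le)
    also have "\<dots> = p" using that by (simp add: sup_absorb1)
    finally show False using p(2) by blast
  qed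
  \<comment> \<open>Exponent 0 is among the avoided powers, so \<open>1\<close> is not below
    \<open>p\<close>.\<close>
  moreover have "p < 1" using p(2)[of 0] quantale_le_one[of p] by (auto simp: less_le)
  ultimately have "m_prime p" by (simp add: m_prime_def)
  with p that show thesis by (metis power_one_right)
qed

text \<open>If no power of \<open>c\<close> were below \<open>a\<close>, a prime above
  \<open>a\<close> but not above \<open>c\<close> would contradict \<open>c \<le> radical a\<close>.
  The converse holds because primes absorb roots.\<close>

lemma compact_le_radical_iff:
  fixes a c :: "'a::coherent_quantale"
  assumes "compact_element c"
  shows "c \<le> radical a \<longleftrightarrow> (\<exists>n\<ge>1. c ^ n \<le> a)"
proof
  assume c: "c \<le> radical a"
  have "\<exists>n. c ^ n \<le> a"
  proof (rule ccontr)
    assume "\<nexists>n. c ^ n \<le> a"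
    then have "\<not> c ^ n \<le> a" for n by blast
    then obtain p where "m_prime p" "a \<le> p" "\<not> c \<le> p"
      by (rule m_prime_avoiding_powers[OF assms])
    then have "radical a \<le> p" unfolding radical_def Spec_def by (auto intro: Inf_lower)
    with c \<open>\<not> c \<le> p\<close> show False by (metis order_trans)
  qed
  then obtain n where "c ^ n \<le> a" ..
  \<comment> \<open>The exponent found may be 0; one further factor makes it positive.\<close>
  then have "c ^ Suc n \<le> a" unfolding power_Suc by (rule order_trans[OF mult_le_right])
  then show "\<exists>n\<ge>1. c ^ n \<le> a" by (intro exI[of _ "Suc n"]) simp
next
  assume "\<exists>n\<ge>1. c ^ n \<le> a"
  then obtain n where "c ^ n \<le> a" by blast
  then show "c \<le> radical a" by (rule radical_power[OF order_trans[OF _ le_radical]])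
qed

lemma w_pure_radical:
  fixes a :: "'a::coherent_quantale"
  assumes "w_pure a"
  shows "w_pure (radical a)"
  unfolding w_pure_def
proof (intro allI impI)
  fix c :: 'a assume "compact_element c \<and> c \<le> radical a"
  then have c: "compact_element c" and "c \<le> radical a" by simp_all
  then obtain n where n: "n \<ge> 1" "c ^ n \<le> a"
    unfolding compact_le_radical_iff[OF c] by blast
  have "compact_element (c ^ n)" using c by (rule compact_power)
  with assms n(2) have "sup a (residual (c ^ n) (radical bot)) = 1"
    unfolding w_pure_def by blast
  then have "1 = sup a (residual (c ^ n) (radical bot))" ..
  also have "\<dots> \<le> sup (radical a) (residual c (radical bot))"
    by (rule sup_mono[OF le_radical residual_power_radical_le[OF n(1)]])
  finally show "sup (radical a) (residual c (radical bot)) = 1"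
    by (simp only: one_le_iff)
qed

section \<open>Ideals of bounded lattices\<close>

lemma lattice_ideal_Ann: "lattice_ideal (Ann x)"
  for x :: "'b::{distrib_lattice, bounded_lattice}"
  unfolding lattice_ideal_def Ann_def
proof (intro conjI ballI allI impI)
  have "bot \<in> {y. inf x y = bot}" by simp
  then show "{y. inf x y = bot} \<noteq> {}" by blast
next
  fix y z assume "y \<in> {y. inf x y = bot}" and "z \<le> y"
  then show "z \<in> {y. inf x y = bot}"
    using inf_mono[OF order_refl[of x] \<open>z \<le> y\<close>] by (simp add: bot_unique)
qed (simp add: inf_sup_distrib1)

text \<open>Bounding \<open>z\<close> by \<open>sup x y\<close>, instead of asking for equality,
  makes downward closure immediate.\<close>

lemma ideal_join_eq:
  assumes I: "lattice_ideal I" and J: "lattice_ideal J"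
  shows "ideal_join I J = {z. \<exists>x\<in>I. \<exists>y\<in>J. z \<le> sup x y}" (is "_ = ?K")
  unfolding ideal_join_def
proof (rule hull_unique)
  obtain i j where ij: "i \<in> I" "j \<in> J" using I J by (auto simp: lattice_ideal_def)
  then show "I \<union> J \<subseteq> ?K" by (blast intro: sup.cobounded1 sup.cobounded2)
  have "sup z w \<in> ?K" if zw: "z \<in> ?K" "w \<in> ?K" for z w
  proof -
    obtain x y x' y' where *: "x \<in> I" "y \<in> J" "z \<le> sup x y" "x' \<in> I" "y' \<in> J" "w \<le> sup x' y'"
      using zw by blast
    then have "sup z w \<le> sup (sup x x') (sup y y')"
      using sup_mono[OF *(3,6)] by (simp add: ac_simps)
    moreover have "sup x x' \<in> I" "sup y y' \<in> J" using I J * unfolding lattice_ideal_def by blast+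
    ultimately show ?thesis by blast
  qed
  moreover have "?K \<noteq> {}" using \<open>I \<union> J \<subseteq> ?K\<close> ij by blast
  moreover have "y \<in> ?K" if "x \<in> ?K" "y \<le> x" for x y
    using that by (blast intro: order_trans)
  ultimately show "lattice_ideal ?K"
    unfolding lattice_ideal_def by blast
next
  fix K assume "I \<union> J \<subseteq> K" "lattice_ideal K"
  then show "?K \<subseteq> K" unfolding lattice_ideal_def by blast
qed

text \<open>An ideal is the whole lattice as soon as it contains \<open>top\<close>.\<close>

lemma ideal_join_UNIV_iff:
  assumes "lattice_ideal I" "lattice_ideal J"
  shows "ideal_join I J = UNIV \<longleftrightarrow> (\<exists>x\<in>I. \<exists>y\<in>J. sup x y = top)"
  unfolding ideal_join_eq[OF assms]
proof
  assume "{z. \<exists>x\<in>I. \<exists>y\<in>J. z \<le> sup x y} = UNIV"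
  then have "top \<in> {z. \<exists>x\<in>I. \<exists>y\<in>J. z \<le> sup x y}" by blast
  then show "\<exists>x\<in>I. \<exists>y\<in>J. sup x y = top" by (auto simp: top_unique)
next
  assume "\<exists>x\<in>I. \<exists>y\<in>J. sup x y = top"
  then obtain x y where "x \<in> I" "y \<in> J" "sup x y = top" by blast
  then show "{z. \<exists>x\<in>I. \<exists>y\<in>J. z \<le> sup x y} = UNIV"
    using top_greatest by (intro set_eqI iffI UNIV_I CollectI bexI) simp_all
qed

section \<open>The reticulation and sigma-ideals\<close>

context
  fixes lam :: "'a::coherent_quantale \<Rightarrow> 'b::{distrib_lattice, bounded_lattice}"
  assumes ret: "reticulation lam"
begin

lemma reticulation_surj: obtains c where "compact_element c" "lam c = x"
proof -
  have "x \<in> lam ` {c. compact_element c}" using ret by (simp add: reticulation_def)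
  then show thesis using that by blast
qed

lemma reticulation_mult:
  "compact_element a \<Longrightarrow> compact_element b \<Longrightarrow> lam (a * b) = inf (lam a) (lam b)"
  using ret by (simp add: reticulation_def)

lemma reticulation_le_iff:
  "compact_element a \<Longrightarrow> compact_element b \<Longrightarrow> lam a \<le> lam b \<longleftrightarrow> (\<exists>n\<ge>1. a ^ n \<le> b)"
  using ret by (simp add: reticulation_def)

lemma reticulation_mono:
  assumes "compact_element a" "compact_element b" "a \<le> b"
  shows "lam a \<le> lam b"
  unfolding reticulation_le_iff[OF assms(1,2)]
  using assms(3) by (intro exI[of _ 1]) simp

text \<open>One inequality is an axiom of the reticulation; the other is monotonicity.\<close>

lemma reticulation_sup:
  assumes "compact_element a" "compact_element b"
  shows "lam (sup a b) = sup (lam a) (lam b)"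
proof (rule antisym)
  show "lam (sup a b) \<le> sup (lam a) (lam b)" using ret assms by (simp add: reticulation_def)
  show "sup (lam a) (lam b) \<le> lam (sup a b)"
    using assms by (intro le_supI reticulation_mono compact_sup) auto
qed

lemma reticulation_bot: "lam bot = bot"
proof -
  obtain c where "compact_element c" "lam c = bot" by (rule reticulation_surj)
  then show ?thesis using reticulation_mono[OF compact_bot, of c] by (simp add: bot_unique)
qed

text \<open>Both sides say that some positive power of \<open>c\<close> is below
  \<open>bot\<close>.\<close>

lemma reticulation_eq_bot_iff:
  assumes "compact_element c"
  shows "lam c = bot \<longleftrightarrow> c \<le> radical bot"
proof -
  have "lam c = bot \<longleftrightarrow> lam c \<le> lam bot" by (simp add: reticulation_bot bot_unique)
  then show ?thesis
    by (simp only: reticulation_le_iff[OF assms compact_bot] compact_le_radical_iff[OF assms])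
qed

lemma reticulation_one: "lam 1 = top"
proof -
  obtain c where "compact_element c" "lam c = top" by (rule reticulation_surj)
  then show ?thesis
    using reticulation_mono[OF _ compact_one, of c] by (simp add: quantale_le_one top_unique)
qed

text \<open>All powers of \<open>1\<close> are \<open>1\<close>, so \<open>lam 1 \<le> lam c\<close>
  already forces \<open>1 \<le> c\<close>.\<close>

lemma reticulation_eq_top_iff:
  assumes "compact_element c"
  shows "lam c = top \<longleftrightarrow> c = 1"
proof
  assume "lam c = top"
  then have "lam 1 \<le> lam c" by simp
  then have "1 \<le> c" by (simp add: reticulation_le_iff compact_one assms)
  then show "c = 1" by (simp only: one_le_iff)
qed (simp add: reticulation_one)

text \<open>Compactness replaces the join defining \<open>lower_star lam J\<close> by a finite one;
  \<open>lam\<close> preserves finite joins, so its value there stays in the ideal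
  \<open>J\<close>.\<close>

lemma compact_le_lower_star_iff:
  assumes J: "lattice_ideal J" and c: "compact_element c"
  shows "c \<le> lower_star lam J \<longleftrightarrow> lam c \<in> J"
proof
  show "c \<le> lower_star lam J" if "lam c \<in> J"
    unfolding lower_star_def using that c by (auto intro: Sup_upper)
next
  assume "c \<le> lower_star lam J"
  then obtain F where F: "finite F" "F \<subseteq> {c. compact_element c \<and> lam c \<in> J}" "c \<le> Sup F"
    using c unfolding lower_star_def compact_element_def[of c] by blast
  \<comment> \<open>Handles the empty cover, whose join is \<open>bot\<close>.\<close>
  have bot: "bot \<in> J" using J by (auto simp: lattice_ideal_def)
  from F(1,2) have "compact_element (Sup F) \<and> lam (Sup F) \<in> J"
  proof (induction F rule: finite_induct)
    case empty
    then show ?case by (simp add: compact_bot reticulation_bot bot)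
  next
    case (insert x F)
    then show ?case using J by (simp add: compact_sup reticulation_sup lattice_ideal_def)
  qed
  with c F(3) J show "lam c \<in> J" unfolding lattice_ideal_def by (blast intro: reticulation_mono)
qed

lemma ideal_join_Ann_UNIV_iff:
  assumes J: "lattice_ideal J" and c: "compact_element c"
  shows "ideal_join J (Ann (lam c)) = UNIV \<longleftrightarrow>
    sup (lower_star lam J) (residual c (radical bot)) = 1"
proof -
  \<comment> \<open>Both sides amount to \<open>c * e \<le> radical bot\<close>.\<close>
  have Ann: "lam e \<in> Ann (lam c) \<longleftrightarrow> e \<le> residual c (radical bot)" if "compact_element e" for e
    using reticulation_eq_bot_iff[OF compact_mult[OF c that]]
    by (simp add: Ann_def reticulation_mult c that residual_galois)
  show ?thesis
    unfolding ideal_join_UNIV_iff[OF J lattice_ideal_Ann]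
  proof
    assume "\<exists>x\<in>J. \<exists>y\<in>Ann (lam c). sup x y = top"
    then obtain x y where xy: "x \<in> J" "y \<in> Ann (lam c)" "sup x y = top" by blast
    \<comment> \<open>Surjectivity lifts the two lattice elements to compact elements of the
      quantale.\<close>
    obtain d where d: "compact_element d" "lam d = x" by (rule reticulation_surj)
    obtain e where e: "compact_element e" "lam e = y" by (rule reticulation_surj)
    have "lam (sup d e) = top" using d e xy(3) by (simp add: reticulation_sup)
    then have "1 = sup d e"
      using reticulation_eq_top_iff[OF compact_sup[OF d(1) e(1)]] by simp
    also have "\<dots> \<le> sup (lower_star lam J) (residual c (radical bot))"
    proof (rule sup_mono)
      show "d \<le> lower_star lam J" using compact_le_lower_star_iff[OF J d(1)] d(2) xy(1) by blast
      show "e \<le> residual c (radical bot)" using Ann[OF e(1)] e(2) xy(2) by blast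
    qed
    finally show "sup (lower_star lam J) (residual c (radical bot)) = 1"
      by (simp only: one_le_iff)
  next
    assume "sup (lower_star lam J) (residual c (radical bot)) = 1"
    then have "1 \<le> sup (lower_star lam J) (residual c (radical bot))" by simp
    \<comment> \<open>Compactness of \<open>1\<close> shrinks the two joinands to compact elements,
      to which \<open>lam\<close> applies.\<close>
    then obtain d e where de: "compact_element d" "d \<le> lower_star lam J"
        "compact_element e" "e \<le> residual c (radical bot)" "1 \<le> sup d e"
      by (rule compact_le_sup[OF compact_one])
    then have "sup d e = 1" by (simp only: one_le_iff)
    then have "sup (lam d) (lam e) = top"
      using reticulation_sup[OF de(1,3)] by (simp add: reticulation_one)
    moreover have "lam d \<in> J" using compact_le_lower_star_iff[OF J de(1)] de(2) by blast
    moreover have "lam e \<in> Ann (lam c)" using Ann[OF de(3)] de(4) by blast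
    ultimately show "\<exists>x\<in>J. \<exists>y\<in>Ann (lam c). sup x y = top" by blast
  qed
qed

lemma sigma_ideal_iff_w_pure:
  assumes J: "lattice_ideal J"
  shows "sigma_ideal J \<longleftrightarrow> w_pure (lower_star lam J)"
proof
  assume sigma: "sigma_ideal J"
  show "w_pure (lower_star lam J)"
    unfolding w_pure_def
  proof (intro allI impI)
    fix c :: 'a assume c: "compact_element c \<and> c \<le> lower_star lam J"
    then have "lam c \<in> J" using compact_le_lower_star_iff[OF J] by blast
    with sigma have "ideal_join J (Ann (lam c)) = UNIV" unfolding sigma_ideal_def by blast
    with c show "sup (lower_star lam J) (residual c (radical bot)) = 1"
      using ideal_join_Ann_UNIV_iff[OF J] by blast
  qed
next
  assume pure: "w_pure (lower_star lam J)"
  have "ideal_join J (Ann x) = UNIV" if "x \<in> J" for x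
  proof -
    obtain c where c: "compact_element c" "lam c = x" by (rule reticulation_surj)
    then have "c \<le> lower_star lam J" using that compact_le_lower_star_iff[OF J] by blast
    with pure c have "sup (lower_star lam J) (residual c (radical bot)) = 1"
      unfolding w_pure_def by blast
    with c show ?thesis using ideal_join_Ann_UNIV_iff[OF J] by blast
  qed
  with J show "sigma_ideal J" unfolding sigma_ideal_def by blast
qed

end

theorem corollary4p11:
  fixes lam :: "'a::coherent_quantale \<Rightarrow> 'b::{distrib_lattice, bounded_lattice}"
  assumes "reticulation lam"
  shows "(\<forall>a::'a. w_pure a \<longrightarrow> w_pure (radical a)) \<and>
         (\<forall>J::'b set. lattice_ideal J \<longrightarrow> (sigma_ideal J \<longleftrightarrow> w_pure (lower_star lam J)))"
  using w_pure_radical sigma_ideal_iff_w_pure[OF assms] by blast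

end
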